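(* Let $K\subseteq\mathbb{R}^m$ be a nonempty closed convex set, and let $F:K\to\mathbb{R}^m$ be Lipschitz continuous with constant $L$, i.e., $\|F(x)-F(y)\|\le L\|x-y\|$ for all $x,y\in K$. Let $\varphi:K\to\mathbb{R}^m$ be a strongly monotone mapping with strong monotonicity constant $\mu_\varphi>0$, and let $\tilde x$ be a solution of VI$(K,\varphi)$. Assume that, for some $d<\mu_\varphi$, $\|\varphi(x)-F(x)\|\le d\|x-\tilde x\|$ for all $x\in K$. Let $0<\alpha<\frac1L$, let $x^0\in K$ be arbitrary, and let the sequences $\{x^k\}_{k=0}^\infty$ and $\{y^k\}_{k=0}^\infty$ be generated by the extra-gradient method: for all $k\ge 0$, $$y^k=\Pi_K[x^k-\alpha F(x^k)],\qquad x^{k+1}=\Pi_K[x^k-\alpha F(y^k)].$$ Then $\{x^k\}_{k=0}^\infty$ and $\{y^k\}_{k=0}^\infty$ both converge to $\tilde x$, which is the unique solution of VI$(K,\varphi)$ and is a Minty solution to VI$(K,F)$.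
   Context: For a mapping $G:K\to\mathbb{R}^m$, a solution of VI$(K,G)$ is a point $x^*\in K$ such that $\langle G(x^* ),x-x^*\rangle\ge 0$ for all $x\in K$; a Minty solution of VI$(K,G)$ is a point $x^*\in K$ such that $\langle G(x),x-x^*\rangle\ge 0$ for all $x\in K$. The mapping $\varphi$ is strongly monotone with constant $\mu_\varphi>0$ if $\langle\varphi(x)-\varphi(y),x-y\rangle\ge\mu_\varphi\|x-y\|^2$ for all $x,y\in K$. $\Pi_K[z]$ denotes the Euclidean projection of $z\in\mathbb{R}^m$ on the nonempty closed convex set $K$, i.e., the unique minimizer of $\|x-z\|^2$ over $x\in K$. *)

theory Defs
  imports "HOL-Analysis.Analysis"
begin

(* A mapping K -> R^m is rendered as a total function; all notions below only
   look at its values on K. *)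

definition VI_solution :: "'a::real_inner set \<Rightarrow> ('a \<Rightarrow> 'a) \<Rightarrow> 'a \<Rightarrow> bool" where
  "VI_solution K G z \<longleftrightarrow> z \<in> K \<and> (\<forall>x\<in>K. G z \<bullet> (x - z) \<ge> 0)"

definition Minty_solution :: "'a::real_inner set \<Rightarrow> ('a \<Rightarrow> 'a) \<Rightarrow> 'a \<Rightarrow> bool" where
  "Minty_solution K G z \<longleftrightarrow> z \<in> K \<and> (\<forall>x\<in>K. G x \<bullet> (x - z) \<ge> 0)"

definition strongly_monotone_on :: "'a::real_inner set \<Rightarrow> real \<Rightarrow> ('a \<Rightarrow> 'a) \<Rightarrow> bool" where
  "strongly_monotone_on K \<mu> G \<longleftrightarrow>
     \<mu> > 0 \<and> (\<forall>x\<in>K. \<forall>y\<in>K. (G x - G y) \<bullet> (x - y) \<ge> \<mu> * (norm (x - y))\<^sup>2)"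

(* The projection is the library's closest_point, a point of K at minimal
   distance (unique for nonempty closed convex K). *)

definition extragradient ::
  "('a::euclidean_space) set \<Rightarrow> ('a \<Rightarrow> 'a) \<Rightarrow> real \<Rightarrow> (nat \<Rightarrow> 'a) \<Rightarrow> (nat \<Rightarrow> 'a) \<Rightarrow> bool" where
  "extragradient K F \<alpha> x y \<longleftrightarrow>
     x 0 \<in> K \<and>
     (\<forall>k. y k = closest_point K (x k - \<alpha> *\<^sub>R F (x k)) \<and>
          x (Suc k) = closest_point K (x k - \<alpha> *\<^sub>R F (y k)))"

end

(* The hypotheses make F strongly monotone relative to the point xt alone:
   F z . (z - xt) >= (mu - d) |z - xt|^2 on K.  Put into the classical one-step estimate of the
   extra-gradient method this shows that |x k - xt|^2 decreases geometrically. *)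
theory Submission
  imports Defs
begin

lemma strongly_monotone_VI_solution_lower_bound:
  assumes "strongly_monotone_on K \<mu> G" and "VI_solution K G s" and "z \<in> K"
  shows "\<mu> * (norm (z - s))\<^sup>2 \<le> G z \<bullet> (z - s)"
proof -
  have "\<mu> * (norm (z - s))\<^sup>2 \<le> (G z - G s) \<bullet> (z - s)" and "0 \<le> G s \<bullet> (z - s)"
    using assms unfolding strongly_monotone_on_def VI_solution_def by auto
  then show ?thesis
    by (simp add: inner_diff_left)
qed

text \<open>The inequality for \<open>z\<close>, tested at \<open>s\<close>, makes
  \<open>G z \<bullet> (z - s)\<close> nonpositive, while strong monotonicity together with the
  inequality for \<open>s\<close> bounds it below by a positive multiple of the squared
  distance.\<close>

lemma VI_solution_unique:
  assumes mono: "strongly_monotone_on K \<mu> G" and s: "VI_solution K G s" and z: "VI_solution K G z"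
  shows "z = s"
proof -
  have K: "s \<in> K" "z \<in> K"
    using s z unfolding VI_solution_def by auto
  have "\<mu> * (norm (z - s))\<^sup>2 \<le> G z \<bullet> (z - s)"
    using strongly_monotone_VI_solution_lower_bound[OF mono s] K by blast
  also have "\<dots> \<le> 0"
    using z K unfolding VI_solution_def
    by (metis inner_minus_right minus_diff_eq neg_0_le_iff_le)
  finally have "(norm (z - s))\<^sup>2 \<le> 0"
    using mono unfolding strongly_monotone_on_def by (simp add: mult_le_0_iff)
  then show ?thesis
    by simp
qed

text \<open>Since the deviation of \<open>F\<close> from \<open>G\<close> is measured by the
  distance to \<open>s\<close>, Cauchy-Schwarz turns it into an error quadratic in that distance,
  which lowers the modulus by \<open>d\<close>. No monotonicity of \<open>F\<close> between two
  arbitrary points results.\<close>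

lemma perturbed_strongly_monotone_lower_bound:
  assumes "strongly_monotone_on K \<mu> G" and "VI_solution K G s" and "z \<in> K"
    and "norm (G z - F z) \<le> d * norm (z - s)"
  shows "(\<mu> - d) * (norm (z - s))\<^sup>2 \<le> F z \<bullet> (z - s)"
proof -
  have "(G z - F z) \<bullet> (z - s) \<le> norm (G z - F z) * norm (z - s)"
    by (rule norm_cauchy_schwarz)
  also have "\<dots> \<le> d * norm (z - s) * norm (z - s)"
    using assms(4) by (rule mult_right_mono) simp
  finally show ?thesis
    using strongly_monotone_VI_solution_lower_bound[OF assms(1-3)]
    by (simp add: inner_diff_left power2_eq_square algebra_simps)
qed

text \<open>Both projections are used through their obtuse-angle inequality, the first tested at
  \<open>u\<close> and the second at \<open>t\<close>. The first one involves \<open>F x\<close>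
  instead of \<open>F y\<close>; the Lipschitz bound pays for the exchange.\<close>

lemma extragradient_step_estimate:
  fixes K :: "'a::euclidean_space set"
  assumes K: "closed K" "convex K" and F: "L-lipschitz_on K F" and \<alpha>: "0 \<le> \<alpha>"
    and xK: "x \<in> K" and tK: "t \<in> K"
    and y: "y = closest_point K (x - \<alpha> *\<^sub>R F x)"
    and u: "u = closest_point K (x - \<alpha> *\<^sub>R F y)"
  shows "(norm (u - t))\<^sup>2 \<le>
    (norm (x - t))\<^sup>2 - (1 - (\<alpha> * L)\<^sup>2) * (norm (x - y))\<^sup>2 - 2 * \<alpha> * (F y \<bullet> (y - t))"
proof -
  have yK: "y \<in> K" and uK: "u \<in> K"
    unfolding y u using closest_point_in_set K(1) xK by blast+
  have pu: "(x - \<alpha> *\<^sub>R F y - u) \<bullet> (t - u) \<le> 0"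
    unfolding u using closest_point_dot K(2,1) tK by blast
  have "(x - \<alpha> *\<^sub>R F x - y) \<bullet> (u - y) \<le> 0"
    using closest_point_dot[OF K(2,1) uK] y by metis
  moreover have "(F x - F y) \<bullet> (u - y) \<le> L * norm (x - y) * norm (u - y)"
  proof -
    have "(F x - F y) \<bullet> (u - y) \<le> norm (F x - F y) * norm (u - y)"
      by (rule norm_cauchy_schwarz)
    also have "\<dots> \<le> L * norm (x - y) * norm (u - y)"
      using lipschitz_on_normD[OF F xK yK] by (rule mult_right_mono) simp
    finally show ?thesis .
  qed
  then have "\<alpha> * ((F x - F y) \<bullet> (u - y)) \<le> \<alpha> * (L * norm (x - y) * norm (u - y))"
    using \<alpha> by (rule mult_left_mono)
  ultimately have "2 * ((x - \<alpha> *\<^sub>R F y - y) \<bullet> (u - y)) \<le> 2 * (\<alpha> * L * norm (x - y)) * norm (u - y)"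
    by (simp add: inner_diff_left algebra_simps)
  \<comment> \<open>This splitting puts weight exactly one on the squared norm of
    \<open>u - y\<close>, so that it cancels against the negative term of the identity
    below.\<close>
  also have "\<dots> \<le> (\<alpha> * L * norm (x - y))\<^sup>2 + (norm (u - y))\<^sup>2"
    by (rule sum_squares_bound)
  finally have py: "2 * ((x - \<alpha> *\<^sub>R F y - y) \<bullet> (u - y)) \<le>
      (\<alpha> * L)\<^sup>2 * (norm (x - y))\<^sup>2 + (norm (u - y))\<^sup>2"
    by (simp add: power_mult_distrib)
  \<comment> \<open>Expand around \<open>u\<close>, then split \<open>x - u\<close> through
    \<open>y\<close>. The terms with \<open>F y\<close> add up to zero because
    \<open>(t - u) + (u - y) + (y - t) = 0\<close>.\<close>
  have "(norm (u - t))\<^sup>2 = (norm (x - t))\<^sup>2 - (norm (x - y))\<^sup>2 - (norm (u - y))\<^sup>2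
      + 2 * ((x - \<alpha> *\<^sub>R F y - u) \<bullet> (t - u)) + 2 * ((x - \<alpha> *\<^sub>R F y - y) \<bullet> (u - y))
      - 2 * \<alpha> * (F y \<bullet> (y - t))"
    by (simp add: power2_norm_eq_inner inner_diff_left inner_diff_right inner_commute algebra_simps)
  with pu py show ?thesis
    by (simp add: algebra_simps)
qed

text \<open>Half of the parallelogram law; it converts the two gains of one step, measured at
  \<open>y\<close>, into a fraction of the squared distance from \<open>x\<close> to
  \<open>t\<close>.\<close>

lemma norm_diff_squared_le_twice:
  fixes x y t :: "'a::real_inner"
  shows "(norm (x - t))\<^sup>2 \<le> 2 * ((norm (x - y))\<^sup>2 + (norm (y - t))\<^sup>2)"
proof -
  have "0 \<le> (norm ((x - y) - (y - t)))\<^sup>2"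
    by simp
  then show ?thesis
    by (simp add: power2_norm_eq_inner inner_diff_left inner_diff_right inner_commute algebra_simps)
qed

lemma extragradient_tendsto:
  fixes K :: "'a::euclidean_space set"
  assumes K: "closed K" "convex K" and F: "L-lipschitz_on K F"
    and \<alpha>: "0 < \<alpha>" "\<alpha> * L < 1" and c: "0 < c" and tK: "t \<in> K"
    and lower: "\<And>z. z \<in> K \<Longrightarrow> c * (norm (z - t))\<^sup>2 \<le> F z \<bullet> (z - t)"
    and eg: "extragradient K F \<alpha> x y"
  shows "x \<longlonglongrightarrow> t" and "y \<longlonglongrightarrow> t"
proof -
  have ystep: "y k = closest_point K (x k - \<alpha> *\<^sub>R F (x k))"
    and xstep: "x (Suc k) = closest_point K (x k - \<alpha> *\<^sub>R F (y k))" for k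
    using eg unfolding extragradient_def by auto
  have xK: "x k \<in> K" for k
  proof (cases k)
    case 0
    then show ?thesis using eg unfolding extragradient_def by simp
  next
    case (Suc j)
    then show ?thesis using xstep closest_point_in_set K(1) tK by fastforce
  qed
  have yK: "y k \<in> K" for k
    unfolding ystep using closest_point_in_set K(1) tK by blast
  \<comment> \<open>A common lower bound for the two gain coefficients of a step. It is positive
    because \<open>\<alpha> * L < 1\<close> and \<open>c > 0\<close>; being at most 1, it keeps the
    ratio \<open>1 - m / 2\<close> between 0 and 1.\<close>
  define m where "m = min (1 - (\<alpha> * L)\<^sup>2) (2 * \<alpha> * c)"
  have "0 \<le> \<alpha> * L"
    using lipschitz_on_nonneg[OF F] \<alpha>(1) by simp
  then have "(\<alpha> * L)\<^sup>2 < 1"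
    using \<alpha>(2) by (simp add: power_less_one_iff)
  then have m: "0 < m" "m \<le> 1"
    using \<alpha>(1) c unfolding m_def by (auto simp: min_le_iff_disj)
  define D where "D k = (norm (x k - t))\<^sup>2" for k
  have descent: "D (Suc k) \<le> D k - m * ((norm (x k - y k))\<^sup>2 + (norm (y k - t))\<^sup>2)" for k
  proof -
    have "D (Suc k) \<le> D k - (1 - (\<alpha> * L)\<^sup>2) * (norm (x k - y k))\<^sup>2 - 2 * \<alpha> * (F (y k) \<bullet> (y k - t))"
      unfolding D_def
      using extragradient_step_estimate[OF K F _ xK tK ystep xstep] \<alpha>(1) by simp
    moreover have "m * (norm (x k - y k))\<^sup>2 \<le> (1 - (\<alpha> * L)\<^sup>2) * (norm (x k - y k))\<^sup>2"
      by (rule mult_right_mono) (auto simp: m_def)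
    moreover have "m * (norm (y k - t))\<^sup>2 \<le> (2 * \<alpha> * c) * (norm (y k - t))\<^sup>2"
      by (rule mult_right_mono) (auto simp: m_def)
    \<comment> \<open>The lower bound on \<open>F\<close> enters only here, at the intermediate
      point \<open>y k\<close>.\<close>
    moreover have "2 * \<alpha> * (c * (norm (y k - t))\<^sup>2) \<le> 2 * \<alpha> * (F (y k) \<bullet> (y k - t))"
      using lower[OF yK] \<alpha>(1) by (intro mult_left_mono) auto
    ultimately show ?thesis
      by (simp add: algebra_simps)
  qed
  have contraction: "D (Suc k) \<le> (1 - m / 2) * D k" for k
  proof -
    have "m * D k \<le> m * (2 * ((norm (x k - y k))\<^sup>2 + (norm (y k - t))\<^sup>2))"
      unfolding D_def using m(1) by (intro mult_left_mono norm_diff_squared_le_twice) auto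
    with descent[of k] show ?thesis
      by (simp add: algebra_simps)
  qed
  have "D k \<le> (1 - m / 2) ^ k * D 0" for k
  proof (induction k)
    case (Suc k)
    have "D (Suc k) \<le> (1 - m / 2) * D k"
      by (rule contraction)
    also have "\<dots> \<le> (1 - m / 2) * ((1 - m / 2) ^ k * D 0)"
      using Suc m by (intro mult_left_mono) auto
    finally show ?case
      by (simp add: mult.assoc)
  qed simp
  moreover have "(\<lambda>k. (1 - m / 2) ^ k * D 0) \<longlonglongrightarrow> 0"
    using m by (intro tendsto_mult_left_zero LIMSEQ_power_zero) auto
  moreover have "0 \<le> D k" for k
    by (simp add: D_def)
  ultimately have D0: "D \<longlonglongrightarrow> 0"
    by (intro tendsto_sandwich[where f = "\<lambda>_. 0" and g = D
          and h = "\<lambda>k. (1 - m / 2) ^ k * D 0"] always_eventually allI tendsto_const)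
  have norm_tendsto: "z \<longlonglongrightarrow> t" if "(\<lambda>k. (norm (z k - t))\<^sup>2) \<longlonglongrightarrow> 0" for z :: "nat \<Rightarrow> 'a"
    using tendsto_real_sqrt[OF that] by (simp add: LIM_zero_cancel tendsto_norm_zero_iff)
  show "x \<longlonglongrightarrow> t"
    using D0 by (intro norm_tendsto) (simp flip: D_def)
  \<comment> \<open>The same descent inequality also controls \<open>y k\<close>, once the
    nonnegative \<open>D (Suc k)\<close> and the gain from \<open>x k - y k\<close> are
    dropped.\<close>
  have "(norm (y k - t))\<^sup>2 \<le> D k / m" for k
  proof -
    have "0 \<le> D (Suc k)" "0 \<le> m * (norm (x k - y k))\<^sup>2"
      using m(1) by (simp_all add: D_def)
    then have "m * (norm (y k - t))\<^sup>2 \<le> D k"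
      using descent[of k] by (simp add: algebra_simps)
    then show ?thesis
      using m(1) by (simp add: pos_le_divide_eq mult.commute)
  qed
  moreover have "(\<lambda>k. D k / m) \<longlonglongrightarrow> 0"
    using tendsto_divide[OF D0 tendsto_const, of m] m(1) by simp
  ultimately show "y \<longlonglongrightarrow> t"
    by (intro norm_tendsto tendsto_sandwich[where f = "\<lambda>_. 0"
          and g = "\<lambda>k. (norm (y k - t))\<^sup>2" and h = "\<lambda>k. D k / m"]
        always_eventually allI tendsto_const zero_le_power2)
qed

theorem theorem9:
  fixes K :: "(real ^ 'm) set"
    and F \<phi> :: "real ^ 'm \<Rightarrow> real ^ 'm"
    and x y :: "nat \<Rightarrow> real ^ 'm"
    and xt :: "real ^ 'm"
    and L \<mu> d \<alpha> :: real
  assumes "K \<noteq> {}" and "closed K" and "convex K"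
    and "L-lipschitz_on K F"
    and "strongly_monotone_on K \<mu> \<phi>"
    and "VI_solution K \<phi> xt"
    and "d < \<mu>"
    and "\<And>z. z \<in> K \<Longrightarrow> norm (\<phi> z - F z) \<le> d * norm (z - xt)"
    and "0 < \<alpha>" and "\<alpha> < 1 / L"
    and "extragradient K F \<alpha> x y"
  shows "x \<longlonglongrightarrow> xt \<and> y \<longlonglongrightarrow> xt
    \<and> (\<forall>z. VI_solution K \<phi> z \<longleftrightarrow> z = xt)
    \<and> Minty_solution K F xt"
proof -
  have xtK: "xt \<in> K"
    using assms(6) unfolding VI_solution_def by simp
  have lower: "(\<mu> - d) * (norm (z - xt))\<^sup>2 \<le> F z \<bullet> (z - xt)" if "z \<in> K" for z
    using assms(5,6) that assms(8)[OF that] by (rule perturbed_strongly_monotone_lower_bound)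
  have "0 \<le> L"
    using assms(4) by (rule lipschitz_on_nonneg)
  \<comment> \<open>\<open>L = 0\<close> is excluded, because then \<open>1 / L = 0\<close>.\<close>
  with assms(9,10) have "0 < L"
    by (cases "L = 0") auto
  with assms(10) have "\<alpha> * L < 1"
    by (simp add: field_simps)
  then have "x \<longlonglongrightarrow> xt" "y \<longlonglongrightarrow> xt"
    using extragradient_tendsto[OF assms(2-4,9) _ _ xtK lower assms(11)] assms(7) by auto
  \<comment> \<open>The Minty inequality is \<open>lower\<close> without its quadratic margin, which
    is nonnegative by \<open>d < \<mu>\<close>.\<close>
  moreover have "Minty_solution K F xt"
    unfolding Minty_solution_def
  proof (intro conjI ballI xtK)
    fix z
    assume "z \<in> K"
    have "0 \<le> (\<mu> - d) * (norm (z - xt))\<^sup>2"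
      using assms(7) by simp
    with lower[OF \<open>z \<in> K\<close>] show "0 \<le> F z \<bullet> (z - xt)"
      by linarith
  qed
  ultimately show ?thesis
    using VI_solution_unique[OF assms(5,6)] assms(6) by blast
qed

end
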